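(* For every positive integer $N$, \[ \sum_{\substack{\pi\in\mathcal{O}\\ |\pi|=N}} (-1)^{s(\pi)+1} \;=\; \sum_{\substack{\pi\in\mathcal{U}\\ |\pi|=N}} \tau(\pi), \qquad\text{where}\qquad \tau(\pi) = \sum_{i=1}^{m(\pi)} \chi\big(f_i(\pi)\equiv 1 \ (\mathrm{mod}\ 2)\big)\, 2^{\nu_d(\pi,i)}. \]
   Context: A partition is a finite non-increasing sequence of positive integers (its parts); $|\pi|$ is the sum of the parts and $s(\pi)$ the smallest part. An overpartition is a partition in which the last occurrence of each distinct part size may or may not be marked (overlined); its norm $|\pi|$ and smallest part $s(\pi)$ are defined as for partitions. $\mathcal{U}$ is the set of all non-empty partitions and $\mathcal{O}$ the set of all non-empty overpartitions. For a partition $\pi$ and positive integer $i$, $f_i(\pi)$ is the number of times $i$ occurs as a part; $m(\pi)$ is the smallest positive integer that is not a part of $\pi$; $\nu_d(\pi,i)$ is the number of distinct part sizes of $\pi$ that are $\geq i$. $\chi(S)$ equals $1$ if the statement $S$ is true and $0$ otherwise. *)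

theory Defs
  imports "HOL-Number_Theory.Cong"
begin

definition is_partition :: "nat list \<Rightarrow> bool" where
  "is_partition \<pi> \<longleftrightarrow> sorted_wrt (\<ge>) \<pi> \<and> (\<forall>p \<in> set \<pi>. p > 0)"

text \<open>An overpartition is a list of pairs (part, mark), where the mark is \<^const>\<open>True\<close> for an
  overlined part. An occurrence may be marked only if the same part size does not occur later.\<close>

definition is_overpartition :: "(nat \<times> bool) list \<Rightarrow> bool" where
  "is_overpartition \<pi> \<longleftrightarrow> is_partition (map fst \<pi>) \<and>
     (\<forall>i j. i < j \<and> j < length \<pi> \<and> fst (\<pi> ! i) = fst (\<pi> ! j) \<longrightarrow> \<not> snd (\<pi> ! i))"

definition partitions :: "nat list set" where
  "partitions = {\<pi>. is_partition \<pi> \<and> \<pi> \<noteq> []}"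

definition overpartitions :: "(nat \<times> bool) list set" where
  "overpartitions = {\<pi>. is_overpartition \<pi> \<and> \<pi> \<noteq> []}"

definition norm_part :: "nat list \<Rightarrow> nat" where
  "norm_part \<pi> = sum_list \<pi>"

definition smallest_part :: "nat list \<Rightarrow> nat" where
  "smallest_part \<pi> = Min (set \<pi>)"

definition norm_over :: "(nat \<times> bool) list \<Rightarrow> nat" where
  "norm_over \<pi> = norm_part (map fst \<pi>)"

definition smallest_over :: "(nat \<times> bool) list \<Rightarrow> nat" where
  "smallest_over \<pi> = smallest_part (map fst \<pi>)"

definition freq :: "nat \<Rightarrow> nat list \<Rightarrow> nat" where
  "freq i \<pi> = count_list \<pi> i"

definition min_missing :: "nat list \<Rightarrow> nat" where
  "min_missing \<pi> = (LEAST k. k > 0 \<and> k \<notin> set \<pi>)"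

definition nu_d :: "nat list \<Rightarrow> nat \<Rightarrow> nat" where
  "nu_d \<pi> i = card {p \<in> set \<pi>. p \<ge> i}"

definition tau :: "nat list \<Rightarrow> int" where
  "tau \<pi> = (\<Sum>i = 1..min_missing \<pi>. of_bool ([freq i \<pi> = 1] (mod 2)) * 2 ^ nu_d \<pi> i)"

text \<open>The index sets of the two sums are finite, so the convention that a sum over an infinite set
  is zero plays no role.\<close>

lemma length_le_norm: "is_partition \<pi> \<Longrightarrow> length \<pi> \<le> norm_part \<pi>"
  by (induction \<pi>) (auto simp: is_partition_def norm_part_def)

lemma parts_le_norm: "p \<in> set \<pi> \<Longrightarrow> p \<le> norm_part \<pi>"
  by (simp add: norm_part_def member_le_sum_list)

lemma finite_partitions_norm: "finite {\<pi> \<in> partitions. norm_part \<pi> = N}"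
proof (rule finite_subset)
  show "{\<pi> \<in> partitions. norm_part \<pi> = N} \<subseteq> {\<pi>. set \<pi> \<subseteq> {..N} \<and> length \<pi> \<le> N}"
    using length_le_norm parts_le_norm by (auto simp: partitions_def)
qed (simp add: finite_lists_length_le)

lemma finite_overpartitions_norm: "finite {\<pi> \<in> overpartitions. norm_over \<pi> = N}"
proof (rule finite_subset)
  show "{\<pi> \<in> overpartitions. norm_over \<pi> = N}
          \<subseteq> {\<pi>. set \<pi> \<subseteq> {..N} \<times> UNIV \<and> length \<pi> \<le> N}"
  proof
    fix \<pi> assume "\<pi> \<in> {\<pi> \<in> overpartitions. norm_over \<pi> = N}"
    then have *: "is_partition (map fst \<pi>)" "norm_part (map fst \<pi>) = N"
      by (auto simp: overpartitions_def is_overpartition_def norm_over_def)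
    have "fst x \<le> N" if "x \<in> set \<pi>" for x
      using parts_le_norm[of "fst x" "map fst \<pi>"] that * by auto
    moreover have "length \<pi> \<le> N"
      using length_le_norm[OF *(1)] * by simp
    ultimately show "\<pi> \<in> {\<pi>. set \<pi> \<subseteq> {..N} \<times> UNIV \<and> length \<pi> \<le> N}"
      by (auto simp: subset_iff)
  qed
qed (simp add: finite_lists_length_le)

end

theory Submission
  imports Defs "HOL-Computational_Algebra.Formal_Power_Series" "HOL-Library.FuncSet"
    "HOL-Library.Multiset"
begin

text \<open>
  Sorting overpartitions by their smallest part $s$, and pairs of a partition and an index in
  \<^const>\<open>tau\<close> by the index $i$, turns the two sides into coefficients of power series. After
  division by $2 \prod_{k \ge 1} (1 + q^k) / (1 - q^k)$ the claim becomes
  \[ \sum_{s \ge 1} (-1)^{s+1} \frac{q^s (q;q)_{s-1}}{(-q;q)_s}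
     = \sum_{i \ge 1} \frac{q^{i(i+1)/2}}{(1 + q^i) (-q;q)_i}. \]
  With $T_i = \sum_{n \ge 0} (-1)^n (q;q)_n q^{i(n+1)} / \prod_{j=i}^{i+n} (1 + q^j)$ the left side is
  $T_1$, and the right side is obtained by iterating Fine's functional equation
  $T_i = \frac{q^i}{1 + q^i} \bigl(\frac{1}{1 + q^i} + T_{i+1}\bigr)$.
  All series and products are truncated and compared modulo $q^{N+1}$.
\<close>

subsection \<open>Fine's functional equation, truncated\<close>

text \<open>Here \<open>r j\<close> stands for the inverse of \<open>1 + x ^ j\<close>.\<close>

definition fine_sum :: "'a::comm_ring_1 \<Rightarrow> (nat \<Rightarrow> 'a) \<Rightarrow> nat \<Rightarrow> nat \<Rightarrow> 'a" where
  "fine_sum x r i M =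
     (\<Sum>n<M. (- 1) ^ n * (\<Prod>k=1..n. 1 - x ^ k) * x ^ (i * (n + 1)) * (\<Prod>j=i..i+n. r j))"

text \<open>The last summand is the error caused by truncation.\<close>

lemma fine_sum_Suc:
  fixes x :: "'a::comm_ring_1"
  assumes r: "\<And>j. j \<ge> i \<Longrightarrow> r j * (1 + x ^ j) = 1"
  shows "fine_sum x r i (Suc M) = x ^ i * r i * (r i + fine_sum x r (Suc i) M) +
           (- 1) ^ M * x ^ (i * (M + 2)) * r i * (\<Prod>k=1..M. 1 - x ^ k) * (\<Prod>j=i..i+M. r j)"
proof (induction M)
  case 0
  have "x ^ i * r i = x ^ i * r i * (r i * (1 + x ^ i))"
    using r[of i] by simp
  then show ?case
    by (simp add: fine_sum_def algebra_simps flip: power_add mult_2_right)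
next
  case (Suc M)
  define V where "V = (\<Prod>k=1..M. 1 - x ^ k)"
  define R where "R = (\<Prod>j=Suc i..Suc (i + M). r j)"
  define y where "y = x ^ i"
  define z where "z = x ^ Suc M"
  have ri: "r i * (1 + y) = 1"
    using r[of i] by (simp add: y_def)
  have R1: "(\<Prod>j=i..i+Suc M. r j) = r i * R"
    by (simp add: R_def prod.atLeast_Suc_atMost)
  have V1: "(\<Prod>k=1..Suc M. 1 - x ^ k) = V * (1 - z)"
    by (simp add: V_def z_def)
  have "r (Suc (i + M)) * (1 + y * z) = 1"
    using r[of "Suc (i + M)"] by (simp add: y_def z_def power_add mult_ac)
  \<comment> \<open>The shorter product is the longer one with its last factor undone, so that all
    correction terms below share the factor \<open>r i * R\<close>.\<close>
  then have R2: "(\<Prod>j=i..i+M. r j) = (r i * R) * (1 + y * z)"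
    unfolding R1[symmetric] by (simp add: mult.assoc)
  have e1: "x ^ (i * (M + 2)) = y ^ (M + 2)" "x ^ (i * (Suc M + 1)) = y ^ (M + 2)"
    "x ^ (i * (Suc M + 2)) = y ^ (M + 2) * y" "x ^ (Suc i * (M + 1)) = y ^ (M + 1) * z"
    by (simp_all add: y_def z_def power_add power_mult_distrib mult_ac flip: power_mult)
  have "fine_sum x r i (Suc (Suc M)) =
          fine_sum x r i (Suc M) + (- 1) ^ Suc M * (V * (1 - z)) * y ^ (M + 2) * (r i * R)"
    by (simp only: fine_sum_def sum.lessThan_Suc e1 R1 V1)
  also have "\<dots> = y * r i * (r i + fine_sum x r (Suc i) M) +
      (- 1) ^ M * y ^ (M + 2) * r i * V * ((r i * R) * (1 + y * z))
      - (- 1) ^ M * (V * (1 - z)) * y ^ (M + 2) * (r i * R)"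
    unfolding Suc.IH e1 R2 V_def[symmetric] y_def[symmetric] by simp
  \<comment> \<open>The last summand is zero because \<open>r i\<close> inverts
    \<open>1 + y\<close>. Adding it turns the step into a polynomial identity in \<open>y\<close>,
    \<open>z\<close>, \<open>V\<close>, \<open>R\<close> and \<open>r i\<close>.\<close>
  also have "\<dots> = y * r i * (r i + (fine_sum x r (Suc i) M + (- 1) ^ M * V * (y ^ (M + 1) * z) * R))
       - (- 1) ^ M * (y ^ (M + 2) * y) * r i * (V * (1 - z)) * (r i * R)
       + (- 1) ^ M * y ^ (M + 2) * V * (r i * R) * (r i * (1 + y) - 1)"
    by (simp add: algebra_simps)
  also have "\<dots> = y * r i * (r i + (fine_sum x r (Suc i) M + (- 1) ^ M * V * (y ^ (M + 1) * z) * R))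
       + (- 1) ^ Suc M * (y ^ (M + 2) * y) * r i * (V * (1 - z)) * (r i * R)"
    unfolding ri by simp
  also have "fine_sum x r (Suc i) M + (- 1) ^ M * V * (y ^ (M + 1) * z) * R = fine_sum x r (Suc i) (Suc M)"
    unfolding fine_sum_def sum.lessThan_Suc e1 V_def R_def by simp
  finally show ?case
    unfolding e1 R1 V1 y_def[symmetric] .
qed

text \<open>Induction on the truncation with \<open>i\<close> free, using
  \<open>fine_sum_Suc\<close> once per step. The remainder for \<open>Suc i\<close> is multiplied by
  \<open>x ^ i\<close> and so gains at least one power of \<open>x\<close>, as \<open>i > 0\<close>;
  the truncation error carries \<open>x ^ (i * (M + 2))\<close>. At \<open>i = 1\<close> this is the
  truncated form of the displayed identity.\<close>

lemma fine_sum_cong: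
  fixes x :: "'a::comm_ring_1"
  assumes "i > 0" and "\<And>j. j > 0 \<Longrightarrow> r j * (1 + x ^ j) = 1"
  shows "x ^ Suc M dvd fine_sum x r i M - (\<Sum>k<M. (\<Prod>j=i..i+k. x ^ j * r j) * r (i + k))"
  using assms(1)
proof (induction M arbitrary: i)
  case 0
  then show ?case by (simp add: fine_sum_def)
next
  case (Suc M)
  define B where "B = (\<Sum>k<M. (\<Prod>j=Suc i..Suc i+k. x ^ j * r j) * r (Suc i + k))"
  have B: "(\<Sum>k<Suc M. (\<Prod>j=i..i+k. x ^ j * r j) * r (i + k)) = x ^ i * r i * (r i + B)"
    by (subst sum.lessThan_Suc_shift)
       (simp add: B_def sum_distrib_left prod.atLeast_Suc_atMost algebra_simps del: prod.cl_ivl_Suc)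
  have "x ^ i * x ^ Suc M dvd x ^ i * (fine_sum x r (Suc i) M - B)"
    unfolding B_def using Suc.IH[of "Suc i"] by (intro mult_dvd_mono) auto
  moreover have "x ^ Suc (Suc M) dvd x ^ i * x ^ Suc M"
    using Suc.prems by (simp flip: power_add power_Suc add: le_imp_power_dvd)
  ultimately have 1: "x ^ Suc (Suc M) dvd x ^ i * (fine_sum x r (Suc i) M - B)"
    by (rule dvd_trans[rotated])
  have "M + 2 \<le> i * (M + 2)"
    using mult_le_mono1[of 1 i "M + 2"] Suc.prems by simp
  then have 2: "x ^ Suc (Suc M) dvd x ^ (i * (M + 2))"
    by (intro le_imp_power_dvd) simp
  have "fine_sum x r i (Suc M) - x ^ i * r i * (r i + B) =
      x ^ i * (fine_sum x r (Suc i) M - B) * r i +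
      x ^ (i * (M + 2)) * ((- 1) ^ M * r i * (\<Prod>k=1..M. 1 - x ^ k) * (\<Prod>j=i..i+M. r j))"
    using Suc.prems assms(2) by (subst fine_sum_Suc) (auto simp: algebra_simps)
  also have "x ^ Suc (Suc M) dvd \<dots>"
    by (intro dvd_add dvd_mult2 1 2)
  finally show ?case unfolding B .
qed

section \<open>Congruences for products and geometric sums\<close>

lemma dvd_diff_prod:
  fixes f g :: "'b \<Rightarrow> 'a::comm_ring_1"
  assumes "\<And>j. j \<in> A \<Longrightarrow> d dvd f j - g j"
  shows "d dvd prod f A - prod g A"
  using assms
proof (induction A rule: infinite_finite_induct)
  case (insert a A)
  have "prod f (insert a A) - prod g (insert a A) =
      f a * (prod f A - prod g A) + (f a - g a) * prod g A"
    using insert.hyps by (simp add: algebra_simps)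
  then show ?case
    using insert by (metis dvd_add dvd_mult dvd_mult2 insertCI)
qed auto

lemma geometric_cong:
  fixes y :: "'a::comm_ring_1"
  assumes "w * (1 - y) = 1"
  shows "y ^ Suc N dvd (\<Sum>m\<le>N. y ^ m) - w"
proof -
  have "(1 - y) * (\<Sum>m\<le>N. y ^ m) = 1 - y ^ Suc N"
    using sum_gp_basic .
  then have "w * (1 - y) * (\<Sum>m\<le>N. y ^ m) = w - y ^ Suc N * w"
    by (simp only: mult.assoc) (simp only: right_diff_distrib mult_1_left mult_1_right mult_ac)
  then have "(\<Sum>m\<le>N. y ^ m) - w = y ^ Suc N * (- w)"
    using assms by simp
  then show ?thesis by simp
qed

text \<open>The left side is a single product over \<open>{1..N}\<close>, so that factorwise
  arguments such as \<open>dvd_diff_prod\<close> reach the split form on the right.\<close>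

lemma prod_split_at:
  fixes f g :: "nat \<Rightarrow> 'a::comm_monoid_mult"
  assumes "s \<in> {1..N}"
  shows "(\<Prod>j=1..N. if j < s then f j else if j = s then c else g j) =
           prod f {1..<s} * c * prod g {s<..N}"
proof -
  have "{1..N} = {1..<s} \<union> ({s} \<union> {s<..N})"
    using assms by auto
  then have "(\<Prod>j=1..N. h j) = prod h {1..<s} * (h s * prod h {s<..N})" for h :: "nat \<Rightarrow> 'a"
    by (simp add: prod.union_disjoint del: One_nat_def) (subst prod.union_disjoint, auto simp: mult_ac)
  then show ?thesis
    by (simp add: mult.assoc)
qed

lemma prod_one_two:
  assumes "finite A"
  shows "(\<Prod>j\<in>A. if P j then 1 else 2 :: 'a::comm_semiring_1) = 2 ^ card {j \<in> A. \<not> P j}"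
  using assms by (simp add: prod.If_cases Int_def)

subsection \<open>Partitions and multiplicity functions\<close>

lemma sum_list_eq_sum_count_le:
  fixes \<pi> :: "nat list"
  assumes "\<forall>p\<in>set \<pi>. p > 0" "sum_list \<pi> \<le> N"
  shows "sum_list \<pi> = (\<Sum>j=1..N. j * count_list \<pi> j)"
proof -
  have "set \<pi> \<subseteq> {1..N}"
    using assms member_le_sum_list[of _ \<pi>] by (force simp: Suc_le_eq)
  then show ?thesis
    using sum_list_map_eq_sum_count2[of \<pi> "{1..N}" "\<lambda>j. j"] by (simp add: mult.commute)
qed

text \<open>A non-increasing list is determined by its multiplicities. Parts and multiplicities are
  at most \<open>N\<close>, so the functions can be taken from a finite extensional function space,
  the index set that arises when a product of sums is expanded.\<close>

lemma bij_betw_partitions_multiplicities: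
  assumes "N > 0"
  shows "bij_betw (\<lambda>\<pi>. restrict (count_list \<pi>) {1..N})
           {\<pi>. \<pi> \<in> partitions \<and> norm_part \<pi> = N}
           {f \<in> {1..N} \<rightarrow>\<^sub>E {..N}. (\<Sum>j=1..N. j * f j) = N}"
    (is "bij_betw ?c ?P ?F")
proof (rule bij_betw_imageI)
  have P: "sorted (rev \<pi>)" "set \<pi> \<subseteq> {1..N}" "sum_list \<pi> = N" "\<forall>p\<in>set \<pi>. p > 0"
    if "\<pi> \<in> ?P" for \<pi>
  proof -
    have *: "is_partition \<pi>" "sum_list \<pi> = N"
      using that by (simp_all add: partitions_def norm_part_def)
    then show "sorted (rev \<pi>)" "\<forall>p\<in>set \<pi>. p > 0" "sum_list \<pi> = N"
      by (simp_all add: is_partition_def sorted_wrt_rev)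
    then show "set \<pi> \<subseteq> {1..N}"
      using parts_le_norm[of _ \<pi>] by (auto simp: norm_part_def Suc_le_eq)
  qed
  show "inj_on ?c ?P"
  proof (rule inj_onI)
    fix \<pi> \<rho> assume 1: "\<pi> \<in> ?P" "\<rho> \<in> ?P" and eq: "?c \<pi> = ?c \<rho>"
    have "count_list \<pi> j = count_list \<rho> j" for j
    proof (cases "j \<in> {1..N}")
      case True
      then show ?thesis using fun_cong[OF eq, of j] by simp
    next
      case False
      then show ?thesis using P(2)[OF 1(1)] P(2)[OF 1(2)] by (metis count_notin subsetD)
    qed
    then have "mset \<pi> = mset \<rho>"
      by (intro multiset_eqI) (simp add: count_mset)
    then have "rev \<pi> = rev \<rho>"
      using P(1)[OF 1(1)] P(1)[OF 1(2)] by (metis mset_rev properties_for_sort)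
    then show "\<pi> = \<rho>" by simp
  qed
  show "?c ` ?P = ?F"
  proof
    show "?c ` ?P \<subseteq> ?F"
    proof
      fix f assume "f \<in> ?c ` ?P"
      then obtain \<pi> where \<pi>: "\<pi> \<in> ?P" "f = ?c \<pi>" by auto
      have "count_list \<pi> j \<le> N" for j
        using count_le_length[of \<pi> j] length_le_norm[of \<pi>] \<pi>(1) by (simp add: partitions_def)
      moreover have "(\<Sum>j=1..N. j * count_list \<pi> j) = N"
        using sum_list_eq_sum_count_le[of \<pi> N] P[OF \<pi>(1)] by simp
      ultimately show "f \<in> ?F"
        using \<pi>(2) by (auto simp: PiE_def)
    qed
    show "?F \<subseteq> ?c ` ?P"
    proof
      fix f assume f: "f \<in> ?F"
      \<comment> \<open>The preimage of \<open>f\<close>: \<open>f j\<close> copies of each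
        \<open>j\<close>, sorted and then reversed, because parts are listed in non-increasing
        order.\<close>
      define M where "M = (\<Sum>j\<in>{1..N}. replicate_mset (f j) j)"
      define \<pi> where "\<pi> = rev (sorted_list_of_multiset M)"
      have cM: "count M j = (if j \<in> {1..N} then f j else 0)" for j
        by (simp add: M_def count_sum)
      have c: "count_list \<pi> j = (if j \<in> {1..N} then f j else 0)" for j
        by (simp add: \<pi>_def cM flip: count_mset)
      have set: "set \<pi> \<subseteq> {1..N}"
      proof
        fix j assume "j \<in> set \<pi>"
        then have "count_list \<pi> j \<noteq> 0"
          by (simp add: count_list_0_iff)
        then show "j \<in> {1..N}"
          by (simp add: c split: if_splits)
      qed
      have "sum_list \<pi> = (\<Sum>j=1..N. j * count_list \<pi> j)"
        using sum_list_map_eq_sum_count2[OF set, of "\<lambda>j. j"] by (simp add: mult.commute)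
      also have "\<dots> = N"
        using f by (simp add: c)
      finally have sum: "sum_list \<pi> = N" .
      \<comment> \<open>Here \<open>N > 0\<close> excludes the empty list.\<close>
      then have "\<pi> \<noteq> []"
        using assms by auto
      moreover have "sorted_wrt (\<ge>) \<pi>"
        by (simp add: \<pi>_def sorted_wrt_rev)
      ultimately have "\<pi> \<in> ?P"
        using set sum by (auto simp: partitions_def is_partition_def norm_part_def Suc_le_eq)
      moreover have "?c \<pi> = f"
      proof
        fix j
        show "?c \<pi> j = f j"
          using f PiE_arb[of f "{1..N}" "\<lambda>_. {..N}" j] by (cases "j \<in> {1..N}") (simp_all add: c)
      qed
      ultimately show "f \<in> ?c ` ?P" by blast
    qed
  qed
qed

lemma fps_const_prod: "fps_const (prod f A) = (\<Prod>x\<in>A. fps_const (f x :: 'a::comm_semiring_1))"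
  by (induction A rule: infinite_finite_induct) (simp_all flip: fps_const_mult)

text \<open>Expanding the product chooses a multiplicity \<open>m\<close> for each size
  \<open>j\<close>, and the coefficient at \<open>N\<close> keeps the choices of norm
  \<open>N\<close>. Truncation at \<open>m \<le> N\<close> loses nothing, since no size occurs more
  than \<open>N\<close> times in a partition of \<open>N\<close>.\<close>

lemma partition_generating_function:
  fixes c :: "nat \<Rightarrow> nat \<Rightarrow> 'a::comm_semiring_1"
  assumes "N > 0"
  shows "fps_nth (\<Prod>j=1..N. \<Sum>m\<le>N. fps_const (c j m) * fps_X ^ (j * m)) N =
           (\<Sum>\<pi> | \<pi> \<in> partitions \<and> norm_part \<pi> = N. \<Prod>j=1..N. c j (count_list \<pi> j))"
proof -
  have "(\<Prod>j=1..N. \<Sum>m\<le>N. fps_const (c j m) * fps_X ^ (j * m)) =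
      (\<Sum>f\<in>{1..N} \<rightarrow>\<^sub>E {..N}. fps_const (\<Prod>j=1..N. c j (f j)) * fps_X ^ (\<Sum>j=1..N. j * f j))"
    by (subst prod_sum_PiE) (simp_all add: prod.distrib power_sum fps_const_prod del: One_nat_def)
  also have "fps_nth \<dots> N = (\<Sum>f\<in>{1..N} \<rightarrow>\<^sub>E {..N}.
      if (\<Sum>j=1..N. j * f j) = N then \<Prod>j=1..N. c j (f j) else 0)"
    unfolding fps_sum_nth by (intro sum.cong) auto
  also have "\<dots> = (\<Sum>f\<in>{f \<in> {1..N} \<rightarrow>\<^sub>E {..N}. (\<Sum>j=1..N. j * f j) = N}. \<Prod>j=1..N. c j (f j))"
    by (intro sum.inter_filter[symmetric] finite_PiE) auto
  also have "\<dots> = (\<Sum>\<pi> | \<pi> \<in> partitions \<and> norm_part \<pi> = N.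
      \<Prod>j=1..N. c j (restrict (count_list \<pi>) {1..N} j))"
    by (rule sum.reindex_bij_betw[OF bij_betw_partitions_multiplicities[OF assms], symmetric])
  finally show ?thesis by simp
qed

section \<open>Counting the overlinings of a partition\<close>

abbreviation last_marked :: "('a \<times> bool) list \<Rightarrow> bool" where
  "last_marked \<equiv> sorted_wrt (\<lambda>p q. fst p = fst q \<longrightarrow> \<not> snd p)"

text \<open>Prepending \<open>x\<close> leaves its mark free if \<open>x\<close> does not occur
  later and forces it to be unmarked otherwise. Hence each distinct entry contributes one factor 2,
  whatever the order of the list.\<close>

lemma finite_card_last_marked:
  "finite {\<rho>. map fst \<rho> = \<pi> \<and> last_marked \<rho>} \<and>
   card {\<rho>. map fst \<rho> = \<pi> \<and> last_marked \<rho>} = 2 ^ card (set \<pi>)"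
proof (induction \<pi>)
  case Nil
  have "{\<rho> :: ('a \<times> bool) list. map fst \<rho> = [] \<and> last_marked \<rho>} = {[]}"
    by auto
  then show ?case by simp
next
  case (Cons x \<pi>)
  define B where "B = (if x \<in> set \<pi> then {False} else UNIV)"
  define L where "L = {\<rho>. map fst \<rho> = \<pi> \<and> last_marked \<rho>}"
  have "{\<rho>. map fst \<rho> = x # \<pi> \<and> last_marked \<rho>} = (\<lambda>(b, \<rho>). (x, b) # \<rho>) ` (B \<times> L)"
    by (auto simp: B_def L_def image_iff map_eq_Cons_conv split: if_splits)
  moreover have "inj_on (\<lambda>(b, \<rho>). (x, b) # \<rho>) (B \<times> L)"
    by (auto simp: inj_on_def)
  moreover have "finite B" "card B = (if x \<in> set \<pi> then 1 else 2)"
    by (auto simp: B_def)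
  moreover have "finite L" "card L = 2 ^ card (set \<pi>)"
    using Cons.IH by (auto simp: L_def)
  ultimately show ?case
    by (simp add: card_image card_cartesian_product card_insert_if)
qed

lemma sum_overpartitions:
  "(\<Sum>\<rho> | \<rho> \<in> overpartitions \<and> norm_over \<rho> = N. g (map fst \<rho>)) =
   (\<Sum>\<pi> | \<pi> \<in> partitions \<and> norm_part \<pi> = N. 2 ^ card (set \<pi>) * (g \<pi> :: 'a::comm_semiring_1))"
proof -
  let ?O = "{\<rho>. \<rho> \<in> overpartitions \<and> norm_over \<rho> = N}"
  let ?P = "{\<pi>. \<pi> \<in> partitions \<and> norm_part \<pi> = N}"
  \<comment> \<open>\<open>last_marked\<close> is the index condition of
    \<open>is_overpartition\<close>, put in a form that unfolds along list induction.\<close>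
  have over: "\<rho> \<in> ?O \<longleftrightarrow> map fst \<rho> \<in> ?P \<and> last_marked \<rho>" for \<rho>
    by (auto simp: overpartitions_def is_overpartition_def partitions_def norm_over_def
        sorted_wrt_iff_nth_less)
  have "(\<Sum>\<rho>\<in>?O. g (map fst \<rho>)) = (\<Sum>\<pi>\<in>?P. \<Sum>\<rho>\<in>{\<rho> \<in> ?O. map fst \<rho> = \<pi>}. g (map fst \<rho>))"
    using over finite_overpartitions_norm[of N] finite_partitions_norm[of N]
    by (intro sum.group[symmetric]) auto
  also have "\<dots> = (\<Sum>\<pi>\<in>?P. 2 ^ card (set \<pi>) * g \<pi>)"
  proof (rule sum.cong[OF refl])
    fix \<pi> assume "\<pi> \<in> ?P"
    then have "{\<rho> \<in> ?O. map fst \<rho> = \<pi>} = {\<rho>. map fst \<rho> = \<pi> \<and> last_marked \<rho>}"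
      using over by auto
    then show "(\<Sum>\<rho>\<in>{\<rho> \<in> ?O. map fst \<rho> = \<pi>}. g (map fst \<rho>)) = 2 ^ card (set \<pi>) * g \<pi>"
      using finite_card_last_marked[of \<pi>] by simp
  qed
  finally show ?thesis .
qed

subsection \<open>Weights relative to a distinguished part size\<close>

text \<open>This and the next two lemmas evaluate the Euler factors modulo \<open>y ^ Suc N\<close>:
  \<open>y / (1 - y)\<close> for a size that must occur, \<open>(1 + y) / (1 - y)\<close> for a size
  that may be overlined, and \<open>2 y / (1 - y^2)\<close> for a size of odd multiplicity with a
  factor 2.\<close>

lemma sum_positive_powers_cong:
  fixes y :: "'a::comm_ring_1"
  assumes w: "w * (1 - y) = 1"
  shows "y ^ Suc N dvd (\<Sum>m\<le>N. of_bool (m > 0) * y ^ m) - y * w"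
proof -
  have "(\<Sum>m\<le>N. of_bool (m > 0) * y ^ m) = (\<Sum>m\<le>N. y ^ m) - 1"
    by (induction N) auto
  moreover have "y * w = w - 1"
    using w by (simp add: algebra_simps)
  ultimately show ?thesis
    using geometric_cong[OF w, of N] by simp
qed

lemma sum_one_two_powers_cong:
  fixes y :: "'a::comm_ring_1"
  assumes w: "w * (1 - y) = 1"
  shows "y ^ Suc N dvd (\<Sum>m\<le>N. (if m = 0 then 1 else 2) * y ^ m) - (1 + y) * w"
proof -
  have "(\<Sum>m\<le>N. (if m = 0 then 1 else 2) * y ^ m) = 2 * (\<Sum>m\<le>N. y ^ m) - 1"
    by (induction N) (auto simp: algebra_simps)
  moreover have "(1 + y) * w = 2 * w - 1"
    using w by (simp add: algebra_simps)
  ultimately show ?thesis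
    using dvd_mult[OF geometric_cong[OF w, of N], of 2] by (simp add: right_diff_distrib)
qed

lemma sum_odd_powers_cong:
  fixes y :: "'a::comm_ring_1"
  assumes w: "w * (1 - y) = 1" and r: "r * (1 + y) = 1"
  shows "y ^ Suc N dvd (\<Sum>m\<le>N. 2 * of_bool (odd m) * y ^ m) - 2 * y * w * r"
proof -
  have "y ^ Suc N dvd (- y) ^ Suc N"
    by (subst power_minus) simp
  also have "\<dots> dvd (\<Sum>m\<le>N. (- y) ^ m) - r"
    using r by (intro geometric_cong) simp
  finally have R: "y ^ Suc N dvd (\<Sum>m\<le>N. (- y) ^ m) - r" .
  \<comment> \<open>Partial fractions: twice the odd part of the geometric series is
    \<open>1 / (1 - y) - 1 / (1 + y)\<close>.\<close>
  have "2 * y * w * r = w * r * ((1 + y) - (1 - y))"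
    by (simp add: algebra_simps)
  also have "\<dots> = w * (r * (1 + y)) - r * (w * (1 - y))"
    by (simp only: right_diff_distrib mult_ac)
  also have "\<dots> = w - r"
    using w r by simp
  finally have wr: "2 * y * w * r = w - r" .
  have "(\<Sum>m\<le>N. 2 * of_bool (odd m) * y ^ m) = (\<Sum>m\<le>N. y ^ m - (- y) ^ m)"
    by (intro sum.cong) auto
  then have "(\<Sum>m\<le>N. 2 * of_bool (odd m) * y ^ m) - 2 * y * w * r =
      ((\<Sum>m\<le>N. y ^ m) - w) - ((\<Sum>m\<le>N. (- y) ^ m) - r)"
    by (simp add: wr sum_subtractf)
  then show ?thesis
    using dvd_diff[OF geometric_cong[OF w, of N] R] by simp
qed

text \<open>The weight of \<open>m\<close> occurrences of the part size \<open>j\<close>, relative to a distinguished part size \<open>i\<close>;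
  above \<open>i\<close> it counts the choices of an overline.\<close>

definition weight :: "(nat \<Rightarrow> 'a::comm_semiring_1) \<Rightarrow> (nat \<Rightarrow> 'a) \<Rightarrow> nat \<Rightarrow> nat \<Rightarrow> nat \<Rightarrow> 'a" where
  "weight a b i j m = (if j < i then a m else if j = i then b m else if m = 0 then 1 else 2)"

lemma prod_weight:
  assumes "i \<in> {1..N}" "set \<pi> \<subseteq> {1..N}"
  shows "(\<Prod>j=1..N. weight a b i j (count_list \<pi> j)) =
     (\<Prod>j=1..<i. a (count_list \<pi> j)) * b (count_list \<pi> i) * 2 ^ card {p \<in> set \<pi>. p > i}"
proof -
  have "{j \<in> {i<..N}. count_list \<pi> j \<noteq> 0} = {p \<in> set \<pi>. p > i}"
    using assms(2) by (auto simp: count_list_0_iff)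
  then show ?thesis
    using prod_split_at[OF assms(1), of "\<lambda>j. a (count_list \<pi> j)" "b (count_list \<pi> i)"
        "\<lambda>j. if count_list \<pi> j = 0 then 1 else 2"]
    unfolding weight_def
    by (simp add: prod_one_two del: One_nat_def cong: if_cong)
qed

lemma card_set_ge:
  assumes "i \<in> set \<pi>"
  shows "card {p \<in> set \<pi>. p \<ge> i} = Suc (card {p \<in> set \<pi>. p > (i::nat)})"
proof -
  have "{p \<in> set \<pi>. p \<ge> i} = insert i {p \<in> set \<pi>. p > i}"
    using assms by auto
  then show ?thesis by simp
qed

lemma partition_set_bounds:
  assumes "\<pi> \<in> partitions" "norm_part \<pi> = N"
  shows "set \<pi> \<subseteq> {1..N}"
  using assms parts_le_norm[of _ \<pi>]
  by (auto simp: partitions_def is_partition_def Suc_le_eq)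

text \<open>Only \<open>s = smallest_part \<pi>\<close> survives: a smaller \<open>s\<close> does
  not occur, so \<open>b\<close> gives 0, and for a larger \<open>s\<close> the smallest part lies
  below \<open>s\<close>, where \<open>a\<close> gives 0. In the surviving term every occurring size
  contributes a factor 2.\<close>

lemma smallest_part_weight:
  assumes "\<pi> \<in> partitions" "norm_part \<pi> = N"
  shows "2 ^ card (set \<pi>) * (- 1 :: int) ^ (smallest_part \<pi> + 1) =
    (\<Sum>s=1..N. (- 1) ^ (s + 1) *
       (\<Prod>j=1..N. weight (\<lambda>m. of_bool (m = 0)) (\<lambda>m. 2 * of_bool (m > 0)) s j (count_list \<pi> j)))"
    (is "_ = (\<Sum>s=1..N. (- 1) ^ (s + 1) * ?W s)")
proof -
  have set: "set \<pi> \<subseteq> {1..N}"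
    using partition_set_bounds[OF assms] .
  define s0 where "s0 = smallest_part \<pi>"
  have "set \<pi> \<noteq> {}"
    using assms(1) by (simp add: partitions_def)
  then have s0: "s0 \<in> set \<pi>" and min: "\<And>p. p \<in> set \<pi> \<Longrightarrow> s0 \<le> p"
    by (simp_all add: s0_def smallest_part_def)
  have other: "?W s = 0" if "s \<in> {1..N}" "s \<noteq> s0" for s
  proof (cases "s < s0")
    case True
    then have "s \<notin> set \<pi>" using min[of s] by auto
    then show ?thesis by (subst prod_weight[OF that(1) set]) simp
  next
    case False
    then have "(\<Prod>j=1..<s. of_bool (count_list \<pi> j = 0) :: int) = 0"
      using that(2) s0 set by (intro prod_zero bexI[of _ s0]) (auto simp: count_list_0_iff)
    then show ?thesis by (subst prod_weight[OF that(1) set]) simp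
  qed
  have "{p \<in> set \<pi>. p \<ge> s0} = set \<pi>"
    using min by auto
  then have card: "card (set \<pi>) = Suc (card {p \<in> set \<pi>. p > s0})"
    using card_set_ge[OF s0] by simp
  have "(\<Prod>j=1..<s0. of_bool (count_list \<pi> j = 0) :: int) = 1"
    using min by (intro prod.neutral) (force simp: count_list_0_iff)
  moreover have "count_list \<pi> s0 > 0"
    using s0 by (simp add: count_list_0_iff flip: neq0_conv)
  moreover have "s0 \<in> {1..N}"
    using s0 set by blast
  ultimately have "?W s0 = 2 ^ card (set \<pi>)"
    by (subst prod_weight[OF _ set]) (simp_all add: card)
  moreover have "(\<Sum>s=1..N. (- 1) ^ (s + 1) * ?W s) = (\<Sum>s\<in>{s0}. (- 1) ^ (s + 1) * ?W s)"
    using s0 set other by (intro sum.mono_neutral_right) auto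
  ultimately show ?thesis
    by (simp add: s0_def)
qed

text \<open>The \<open>i\<close>-th product is nonzero only if all sizes below \<open>i\<close>
  occur and \<open>i\<close> has odd multiplicity, which forces
  \<open>i < min_missing \<pi>\<close>. The factor 2 in \<open>b\<close> accounts for
  \<open>i\<close> itself in \<open>nu_d \<pi> i\<close>.\<close>

lemma tau_weight:
  assumes "\<pi> \<in> partitions" "norm_part \<pi> = N"
  shows "tau \<pi> = (\<Sum>i=1..N. \<Prod>j=1..N.
    weight (\<lambda>m. of_bool (m > 0)) (\<lambda>m. 2 * of_bool (odd m)) i j (count_list \<pi> j))"
    (is "_ = (\<Sum>i=1..N. ?W i)")
proof -
  have set: "set \<pi> \<subseteq> {1..N}"
    using partition_set_bounds[OF assms] .
  define k where "k = min_missing \<pi>"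
  \<comment> \<open>A witness that the \<open>LEAST\<close> in \<open>min_missing\<close>
    exists.\<close>
  have "N + 1 > 0 \<and> N + 1 \<notin> set \<pi>"
    using set by auto
  then have k: "k > 0" "k \<notin> set \<pi>"
    unfolding k_def min_missing_def by (metis (mono_tags, lifting) LeastI_ex)+
  have below: "j \<in> set \<pi>" if "j < k" "j > 0" for j
    using not_less_Least that unfolding k_def min_missing_def by blast
  \<comment> \<open>The index \<open>k\<close> drops out: the missing size has frequency 0, which is
    even.\<close>
  have "tau \<pi> = (\<Sum>i=1..<k. of_bool (odd (count_list \<pi> i)) * 2 ^ nu_d \<pi> i)"
  proof -
    have "{1..k} = insert k {1..<k}"
      using k by auto
    then show ?thesis
      using k by (simp add: tau_def freq_def cong_def mod2_eq_if flip: k_def)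
  qed
  also have "\<dots> = (\<Sum>i=1..<k. ?W i)"
  proof (rule sum.cong[OF refl])
    fix i assume i: "i \<in> {1..<k}"
    then have "i \<in> set \<pi>" "i \<in> {1..N}"
      using below[of i] set by auto
    moreover have "(\<Prod>j=1..<i. of_bool (count_list \<pi> j > 0) :: int) = 1"
      using i below by (intro prod.neutral) (force simp: count_list_0_iff simp flip: neq0_conv)
    ultimately show "of_bool (odd (count_list \<pi> i)) * 2 ^ nu_d \<pi> i = ?W i"
      by (subst prod_weight[OF _ set]) (simp_all add: nu_d_def card_set_ge)
  qed
  also have "\<dots> = (\<Sum>i=1..N. ?W i)"
  proof (rule sum.mono_neutral_left)
    show "{1..<k} \<subseteq> {1..N}"
      using below set by force
    show "\<forall>i\<in>{1..N} - {1..<k}. ?W i = 0"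
    proof
      fix i assume i: "i \<in> {1..N} - {1..<k}"
      then have iN: "i \<in> {1..N}" by simp
      show "?W i = 0"
      proof (cases "i = k")
        case True
        then show ?thesis using k by (subst prod_weight[OF iN set]) simp
      next
        case False
        then have "(\<Prod>j=1..<i. of_bool (count_list \<pi> j > 0) :: int) = 0"
          using i k by (intro prod_zero bexI[of _ k]) auto
        then show ?thesis by (subst prod_weight[OF iN set]) simp
      qed
    qed
  qed simp
  finally show ?thesis .
qed

section \<open>Closed forms of the weighted generating functions and their comparison\<close>

lemma power_Suc_dvd_power_power: "j > 0 \<Longrightarrow> (x :: 'a::comm_semiring_1) ^ Suc N dvd (x ^ j) ^ Suc N"
  unfolding power_mult[symmetric] by (rule le_imp_power_dvd) (cases j, simp_all)

text \<open>The congruence is checked factor by factor: \<open>\<alpha>\<close> and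
  \<open>\<beta>\<close> are closed forms for the sizes below \<open>i\<close> and for
  \<open>i\<close>, and each larger size gives the overpartition factor
  \<open>(1 + x ^ j) / (1 - x ^ j)\<close>.\<close>

lemma weight_generating_function_cong:
  fixes a b :: "nat \<Rightarrow> 'a::comm_ring_1"
  defines "x \<equiv> fps_X :: 'a fps"
  assumes i: "i \<in> {1..N}"
    and w: "\<And>j. j > 0 \<Longrightarrow> w j * (1 - x ^ j) = 1"
    and a: "\<And>j. j > 0 \<Longrightarrow> x ^ Suc N dvd (\<Sum>m\<le>N. fps_const (a m) * x ^ (j * m)) - \<alpha> j"
    and b: "x ^ Suc N dvd (\<Sum>m\<le>N. fps_const (b m) * x ^ (i * m)) - \<beta>"
  shows "x ^ Suc N dvd (\<Prod>j=1..N. \<Sum>m\<le>N. fps_const (weight a b i j m) * x ^ (j * m)) -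
           prod \<alpha> {1..<i} * \<beta> * (\<Prod>j\<in>{i<..N}. (1 + x ^ j) * w j)"
  unfolding prod_split_at[OF i, symmetric]
proof (rule dvd_diff_prod)
  fix j assume "j \<in> {1..N}"
  then have j: "j > 0" by simp
  have "x ^ Suc N dvd (x ^ j) ^ Suc N"
    using j by (rule power_Suc_dvd_power_power)
  also have "\<dots> dvd (\<Sum>m\<le>N. (if m = 0 then 1 else 2) * (x ^ j) ^ m) - (1 + x ^ j) * w j"
    using w[OF j] by (rule sum_one_two_powers_cong)
  also have "(\<Sum>m\<le>N. (if m = 0 then 1 else 2) * (x ^ j) ^ m) =
      (\<Sum>m\<le>N. fps_const (if m = 0 then 1 else 2) * x ^ (j * m))"
    by (intro sum.cong) (auto simp: power_mult numeral_fps_const)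
  finally show "x ^ Suc N dvd (\<Sum>m\<le>N. fps_const (weight a b i j m) * x ^ (j * m)) -
      (if j < i then \<alpha> j else if j = i then \<beta> else (1 + x ^ j) * w j)"
    using a[OF j] b by (auto simp: weight_def)
qed

text \<open>Extracts the full product of the \<open>p j\<close>, which does not depend on
  \<open>i\<close>: \<open>f\<close> and \<open>c\<close> are the quotients of \<open>h\<close> and
  \<open>d\<close> by the corresponding values of \<open>p\<close>.\<close>

lemma prod_combine:
  fixes f g h k p :: "nat \<Rightarrow> 'a::comm_ring_1"
  assumes "i \<in> {1..N}" "\<And>j. j \<in> {1..<i} \<Longrightarrow> p j * f j = h j" "p i * c = d"
  shows "prod p {1..N} * (prod f {1..<i} * c) = prod h {1..<i} * d * prod p {i<..N}"
proof -
  have "prod p {1..N} = prod p {1..<i} * p i * prod p {i<..N}"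
  proof -
    have "prod p {1..N} = (\<Prod>j=1..N. if j < i then p j else if j = i then p i else p j)"
      by (rule prod.cong) simp_all
    then show ?thesis
      by (simp only: prod_split_at[OF assms(1)])
  qed
  moreover have "prod p {1..<i} * prod f {1..<i} = prod h {1..<i}"
    using assms(2) by (simp flip: prod.distrib)
  moreover have "prod p {1..<i} * p i * prod p {i<..N} * (prod f {1..<i} * c) =
      prod p {1..<i} * prod f {1..<i} * (p i * c) * prod p {i<..N}"
    by (simp only: mult_ac)
  ultimately have "prod p {1..N} * (prod f {1..<i} * c) = prod h {1..<i} * (p i * c) * prod p {i<..N}"
    by (simp only:)
  then show ?thesis
    by (simp only: assms(3))
qed

text \<open>Each inner sum over partitions is a coefficient at \<open>N\<close>. Modulo
  \<open>x ^ Suc N\<close> both combinations of series have the common factor \<open>2 * P\<close>,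
  and the cofactors agree by \<open>fine_sum_cong\<close> at \<open>i = 1\<close>.\<close>

lemma sum_weights_eq:
  fixes N :: nat
  defines "\<P> \<equiv> {\<pi>. \<pi> \<in> partitions \<and> norm_part \<pi> = N}"
  assumes "N > 0"
  shows "(\<Sum>i=1..N. (- 1 :: int) ^ (i + 1) * (\<Sum>\<pi>\<in>\<P>. \<Prod>j=1..N.
            weight (\<lambda>m. of_bool (m = 0)) (\<lambda>m. 2 * of_bool (m > 0)) i j (count_list \<pi> j))) =
         (\<Sum>i=1..N. \<Sum>\<pi>\<in>\<P>. \<Prod>j=1..N.
            weight (\<lambda>m. of_bool (m > 0)) (\<lambda>m. 2 * of_bool (odd m)) i j (count_list \<pi> j))"
proof -
  define x where "x = (fps_X :: int fps)"
  \<comment> \<open>For \<open>j > 0\<close> the constant coefficients are 1, a unit of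
    \<open>int\<close>; the second argument 1 is its inverse.\<close>
  define w where "w j = fps_right_inverse (1 - x ^ j) 1" for j
  define r where "r j = fps_right_inverse (1 + x ^ j) 1" for j
  have w: "w j * (1 - x ^ j) = 1" and r: "r j * (1 + x ^ j) = 1" if "j > 0" for j
    using that fps_right_inverse[of "1 - x ^ j" 1] fps_right_inverse[of "1 + x ^ j" 1]
    by (simp_all add: w_def r_def x_def mult.commute)
  \<comment> \<open>The Euler factor of overpartitions; \<open>P\<close> is their generating
    function restricted to sizes up to \<open>N\<close>.\<close>
  define p where "p j = (1 + x ^ j) * w j" for j
  define P where "P = prod p {1..N}"
  have pr: "p j * ((1 - x ^ j) * r j) = 1" "p j * r j = w j" if "j > 0" for j
  proof -
    have "p j * ((1 - x ^ j) * r j) = (w j * (1 - x ^ j)) * (r j * (1 + x ^ j))"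
      by (simp only: p_def mult_ac)
    then show "p j * ((1 - x ^ j) * r j) = 1"
      using w[OF that] r[OF that] by simp
    have "p j * r j = w j * (r j * (1 + x ^ j))"
      by (simp only: p_def mult_ac)
    then show "p j * r j = w j"
      using r[OF that] by simp
  qed
  define G :: "(nat \<Rightarrow> int) \<Rightarrow> (nat \<Rightarrow> int) \<Rightarrow> nat \<Rightarrow> int fps"
    where "G a b i = (\<Prod>j=1..N. \<Sum>m\<le>N. fps_const (weight a b i j m) * x ^ (j * m))" for a b i
  define L where "L = G (\<lambda>m. of_bool (m = 0)) (\<lambda>m. 2 * of_bool (m > 0))"
  define R where "R = G (\<lambda>m. of_bool (m > 0)) (\<lambda>m. 2 * of_bool (odd m))"
  have cong_pos: "x ^ Suc N dvd (\<Sum>m\<le>N. of_bool (m > 0) * x ^ (j * m)) - x ^ j * w j" if "j > 0" for j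
    using dvd_trans[OF power_Suc_dvd_power_power sum_positive_powers_cong[OF w]] that
    by (simp only: power_mult)
  have const: "fps_const (of_bool b) = (of_bool b :: int fps)"
      "fps_const (2 * of_bool b) = (2 * of_bool b :: int fps)" for b
    by (simp_all add: numeral_fps_const)
  \<comment> \<open>Sizes below \<open>i\<close> are absent and contribute 1, and \<open>i\<close>
    itself contributes \<open>2 x^i / (1 - x^i)\<close>.\<close>
  have L: "x ^ Suc N dvd L i - (\<Prod>j=1..<i. 1) * (2 * (x ^ i * w i)) * prod p {i<..N}"
    if i: "i \<in> {1..N}" for i
    unfolding L_def G_def p_def x_def
  proof (rule weight_generating_function_cong[OF i]; fold x_def)
    show "x ^ Suc N dvd (\<Sum>m\<le>N. fps_const (of_bool (m = 0)) * x ^ (j * m)) - 1" for j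
    proof -
      have "(\<Sum>m\<le>N. fps_const (of_bool (m = 0)) * x ^ (j * m)) = 1"
        by (induction N) (auto simp: const)
      then show ?thesis by simp
    qed
    have "x ^ Suc N dvd 2 * ((\<Sum>m\<le>N. of_bool (m > 0) * x ^ (i * m)) - x ^ i * w i)"
      using cong_pos[of i] i by (intro dvd_mult) simp
    then show "x ^ Suc N dvd (\<Sum>m\<le>N. fps_const (2 * of_bool (m > 0)) * x ^ (i * m)) - 2 * (x ^ i * w i)"
      unfolding const by (simp only: right_diff_distrib sum_distrib_left mult.assoc)
  qed (rule w)
  \<comment> \<open>Sizes below \<open>i\<close> must occur, and \<open>i\<close> itself contributes
    \<open>2 x^i / (1 - x^(2 i))\<close>.\<close>
  have R: "x ^ Suc N dvd R i - (\<Prod>j=1..<i. x ^ j * w j) * (2 * x ^ i * w i * r i) * prod p {i<..N}"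
    if i: "i \<in> {1..N}" for i
    unfolding R_def G_def p_def x_def
  proof (rule weight_generating_function_cong[OF i]; fold x_def)
    show "x ^ Suc N dvd (\<Sum>m\<le>N. fps_const (of_bool (m > 0)) * x ^ (j * m)) - x ^ j * w j"
      if "j > 0" for j
      unfolding const using cong_pos[OF that] .
    show "x ^ Suc N dvd (\<Sum>m\<le>N. fps_const (2 * of_bool (odd m)) * x ^ (i * m)) - 2 * x ^ i * w i * r i"
      unfolding const
      using dvd_trans[OF power_Suc_dvd_power_power sum_odd_powers_cong[OF w r]] i
      by (simp only: power_mult) simp
  qed (rule w)
  \<comment> \<open>Dividing by \<open>p j\<close> turns the factor 1 of a size below
    \<open>i\<close> into \<open>(1 - x^j) / (1 + x^j)\<close>, which is where the numerators of
    \<open>fine_sum\<close> come from.\<close>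
  have L': "(\<Prod>j=1..<i. 1) * (2 * (x ^ i * w i)) * prod p {i<..N} =
      P * ((\<Prod>j=1..<i. (1 - x ^ j) * r j) * (2 * (x ^ i * r i)))" if i: "i \<in> {1..N}" for i
    unfolding P_def
  proof (rule prod_combine[OF i, symmetric])
    show "p j * ((1 - x ^ j) * r j) = 1" if "j \<in> {1..<i}" for j
      using that by (intro pr) simp
    have "p i * (2 * (x ^ i * r i)) = 2 * (x ^ i * (p i * r i))"
      by (simp only: mult_ac)
    then show "p i * (2 * (x ^ i * r i)) = 2 * (x ^ i * w i)"
      using pr(2) i by simp
  qed
  have R': "(\<Prod>j=1..<i. x ^ j * w j) * (2 * x ^ i * w i * r i) * prod p {i<..N} =
      P * ((\<Prod>j=1..<i. x ^ j * r j) * (2 * x ^ i * r i * r i))" if i: "i \<in> {1..N}" for i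
    unfolding P_def
  proof (rule prod_combine[OF i, symmetric])
    show "p j * (x ^ j * r j) = x ^ j * w j" if "j \<in> {1..<i}" for j
      using pr(2)[of j] that by (simp add: mult.left_commute)
    have "p i * (2 * x ^ i * r i * r i) = 2 * x ^ i * (p i * r i) * r i"
      by (simp only: mult_ac)
    then show "p i * (2 * x ^ i * r i * r i) = 2 * x ^ i * w i * r i"
      using pr(2) i by simp
  qed
  have LP: "x ^ Suc N dvd L i - P * ((\<Prod>j=1..<i. (1 - x ^ j) * r j) * (2 * (x ^ i * r i)))"
    if i: "i \<in> {1..N}" for i
    using L[OF i] unfolding L'[OF i] .
  have RP: "x ^ Suc N dvd R i - P * ((\<Prod>j=1..<i. x ^ j * r j) * (2 * x ^ i * r i * r i))"
    if i: "i \<in> {1..N}" for i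
    using R[OF i] unfolding R'[OF i] .
  have "x ^ Suc N dvd (\<Sum>i=1..N. (- 1) ^ (i + 1) * L i) -
      (\<Sum>i=1..N. (- 1) ^ (i + 1) * (P * ((\<Prod>j=1..<i. (1 - x ^ j) * r j) * (2 * (x ^ i * r i)))))"
    unfolding sum_subtractf[symmetric] right_diff_distrib[symmetric]
    by (intro dvd_sum dvd_mult) (rule LP)
  also have "(\<Sum>i=1..N. (- 1) ^ (i + 1) * (P * ((\<Prod>j=1..<i. (1 - x ^ j) * r j) * (2 * (x ^ i * r i))))) =
      2 * P * fine_sum x r 1 N"
  proof -
    \<comment> \<open>Index shift \<open>i = Suc k\<close>: size \<open>i\<close> corresponds to the
      summand \<open>k\<close> of \<open>fine_sum\<close>, with equal sign.\<close>
    have "(- 1) ^ (Suc k + 1) * (P * ((\<Prod>j=1..<Suc k. (1 - x ^ j) * r j) * (2 * (x ^ Suc k * r (Suc k))))) =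
      2 * P * ((- 1) ^ k * (\<Prod>k=1..k. 1 - x ^ k) * x ^ (1 * (k + 1)) * (\<Prod>j=1..1+k. r j))" for k
    proof -
      have "(\<Prod>j=1..1+k. r j) = (\<Prod>j=1..k. r j) * r (Suc k)" "(- 1 :: int fps) ^ (Suc k + 1) = (- 1) ^ k"
        by simp_all
      then show ?thesis
        by (simp only: atLeastLessThanSuc_atLeastAtMost prod.distrib mult_1 Suc_eq_plus1[symmetric] mult_ac)
    qed
    then show ?thesis
      unfolding fine_sum_def sum.atLeast1_atMost_eq[folded One_nat_def] sum_distrib_left
      by (intro sum.cong refl)
  qed
  finally have 1: "x ^ Suc N dvd (\<Sum>i=1..N. (- 1) ^ (i + 1) * L i) - 2 * P * fine_sum x r 1 N" .
  have "x ^ Suc N dvd (\<Sum>i=1..N. R i) -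
      (\<Sum>i=1..N. P * ((\<Prod>j=1..<i. x ^ j * r j) * (2 * x ^ i * r i * r i)))"
    unfolding sum_subtractf[symmetric] by (intro dvd_sum) (rule RP)
  also have "(\<Sum>i=1..N. P * ((\<Prod>j=1..<i. x ^ j * r j) * (2 * x ^ i * r i * r i))) =
      2 * P * (\<Sum>k<N. (\<Prod>j=1..1+k. x ^ j * r j) * r (1 + k))"
  proof -
    have "P * ((\<Prod>j=1..<Suc k. x ^ j * r j) * (2 * x ^ Suc k * r (Suc k) * r (Suc k))) =
      2 * P * ((\<Prod>j=1..1+k. x ^ j * r j) * r (1 + k))" for k
    proof -
      have "(\<Prod>j=1..1+k. x ^ j * r j) = (\<Prod>j=1..k. x ^ j * r j) * (x ^ Suc k * r (Suc k))"
        by simp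
      then show ?thesis
        by (simp only: atLeastLessThanSuc_atLeastAtMost plus_1_eq_Suc mult_ac)
    qed
    then show ?thesis
      unfolding sum.atLeast1_atMost_eq[folded One_nat_def] sum_distrib_left
      by (intro sum.cong refl)
  qed
  finally have 2: "x ^ Suc N dvd (\<Sum>i=1..N. R i) -
      2 * P * (\<Sum>k<N. (\<Prod>j=1..1+k. x ^ j * r j) * r (1 + k))" .
  have 3: "x ^ Suc N dvd 2 * P * fine_sum x r 1 N -
      2 * P * (\<Sum>k<N. (\<Prod>j=1..1+k. x ^ j * r j) * r (1 + k))"
    unfolding right_diff_distrib[symmetric] by (intro dvd_mult fine_sum_cong r) simp_all
  have "x ^ Suc N dvd (\<Sum>i=1..N. (- 1) ^ (i + 1) * L i) - (\<Sum>i=1..N. R i)"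
    using dvd_diff[OF dvd_add[OF 1 3] 2] by simp
  then obtain z where "(\<Sum>i=1..N. (- 1) ^ (i + 1) * L i) - (\<Sum>i=1..N. R i) = x ^ Suc N * z" ..
  then have "fps_nth (\<Sum>i=1..N. (- 1) ^ (i + 1) * L i) N - fps_nth (\<Sum>i=1..N. R i) N =
      fps_nth (x ^ Suc N * z) N"
    by (simp only: flip: fps_sub_nth)
  \<comment> \<open>A multiple of \<open>x ^ Suc N\<close> has coefficient 0 at
    \<open>N\<close>.\<close>
  also have "\<dots> = 0"
    unfolding x_def fps_X_power_mult_nth by simp
  finally have "fps_nth (\<Sum>i=1..N. (- 1) ^ (i + 1) * L i) N = fps_nth (\<Sum>i=1..N. R i) N"
    by simp
  moreover have sgn: "fps_nth ((- 1) ^ k * f) n = (- 1) ^ k * fps_nth f n" for k n and f :: "int fps"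
    by (cases "even k") simp_all
  moreover have G: "fps_nth (G a b i) N = (\<Sum>\<pi>\<in>\<P>. \<Prod>j=1..N. weight a b i j (count_list \<pi> j))" for a b i
    unfolding G_def x_def \<P>_def by (rule partition_generating_function[OF assms(2)])
  ultimately show ?thesis
    unfolding L_def R_def by (simp only: fps_sum_nth sgn G)
qed

theorem theorem3p4:
  fixes N :: nat
  assumes "N > 0"
  shows "(\<Sum>\<pi> | \<pi> \<in> overpartitions \<and> norm_over \<pi> = N. (- 1 :: int) ^ (smallest_over \<pi> + 1)) =
         (\<Sum>\<pi> | \<pi> \<in> partitions \<and> norm_part \<pi> = N. tau \<pi>)"
proof -
  let ?P = "{\<pi>. \<pi> \<in> partitions \<and> norm_part \<pi> = N}"
  have "(\<Sum>\<pi> | \<pi> \<in> overpartitions \<and> norm_over \<pi> = N. (- 1 :: int) ^ (smallest_over \<pi> + 1)) =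
      (\<Sum>\<pi>\<in>?P. 2 ^ card (set \<pi>) * (- 1) ^ (smallest_part \<pi> + 1))"
    unfolding smallest_over_def by (rule sum_overpartitions)
  also have "\<dots> = (\<Sum>\<pi>\<in>?P. \<Sum>i=1..N. (- 1) ^ (i + 1) * (\<Prod>j=1..N.
        weight (\<lambda>m. of_bool (m = 0)) (\<lambda>m. 2 * of_bool (m > 0)) i j (count_list \<pi> j)))"
    by (intro sum.cong refl smallest_part_weight) auto
  also have "\<dots> = (\<Sum>i=1..N. (- 1) ^ (i + 1) * (\<Sum>\<pi>\<in>?P. \<Prod>j=1..N.
        weight (\<lambda>m. of_bool (m = 0)) (\<lambda>m. 2 * of_bool (m > 0)) i j (count_list \<pi> j)))"
    \<comment> \<open>The distinguished size moves outside, so that each inner sum over partitions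
      is the coefficient of one product.\<close>
    unfolding sum_distrib_left by (rule sum.swap)
  also have "\<dots> = (\<Sum>i=1..N. \<Sum>\<pi>\<in>?P. \<Prod>j=1..N.
        weight (\<lambda>m. of_bool (m > 0)) (\<lambda>m. 2 * of_bool (odd m)) i j (count_list \<pi> j))"
    by (rule sum_weights_eq[OF assms])
  also have "\<dots> = (\<Sum>\<pi>\<in>?P. \<Sum>i=1..N. \<Prod>j=1..N.
        weight (\<lambda>m. of_bool (m > 0)) (\<lambda>m. 2 * of_bool (odd m)) i j (count_list \<pi> j))"
    by (rule sum.swap)
  also have "\<dots> = (\<Sum>\<pi>\<in>?P. tau \<pi>)"
    by (intro sum.cong refl tau_weight[symmetric]) auto
  finally show ?thesis .
qed

end
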